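(* Let $M\in\mathbb{R}^{n\times n}$ be a K-matrix and let $q\in\mathbb{R}^n$ be nondegenerate with respect to $M$. Let $\phi$ be the unique-sink orientation of the $n$-cube induced by $\mathrm{LCP}(M,q)$. Then the simple principal pivoting algorithm on $\phi$, with an arbitrary pivot rule and starting at an arbitrary vertex of the $n$-cube, finds the solution to $\mathrm{LCP}(M,q)$ (that is, reaches the sink of $\phi$) in at most $2n$ iterations.
   Context: A P-matrix is a real square matrix all of whose principal minors are positive; a K-matrix is a P-matrix all of whose off-diagonal entries are non-positive. $\mathrm{LCP}(M,q)$ asks for $w,z\in\mathbb{R}^n$ with $w-Mz=q$, $w,z\ge 0$, $w^Tz=0$. Notation: $[n]=\{1,\dots,n\}$; for $v\in\{0,1\}^n$, $v\oplus i$ is $v$ with $i$th entry flipped. The $n$-cube is the graph on $\{0,1\}^n$ with edges $\{v,v\oplus i\}$. For $v\in\{0,1\}^n$ let $B(v)=\{j: v_j=1\}$ and, for $B\subseteq[n]$, let $A_B$ be the $n\times n$ matrix whose $i$th column is the $i$th column of $-M$ if $i\in B$ and the $i$th column of the identity matrix otherwise ($A_B$ is invertible when $M$ is a P-matrix). $q$ is nondegenerate if $(A_B^{-1}q)_i\ne 0$ for all $B\subseteq[n]$, $i\in[n]$. The orientation induced by $\mathrm{LCP}(M,q)$ directs the edge $\{v,v\oplus i\}$ as $v\to v\oplus i$ iff $(A_{B(v)}^{-1}q)_i<0$. It is a unique-sink orientation (every nonempty subcube has a unique sink). Its global sink $t$ satisfies $A_{B(t)}^{-1}q\ge 0$ and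 yields the solution: with $B=B(t)$, $w_i=0,\ z_i=(A_B^{-1}q)_i$ for $i\in B$ and $w_i=(A_B^{-1}q)_i,\ z_i=0$ for $i\notin B$. Simple principal pivoting algorithm: start at a vertex $v$; while $\mathcal{O}=\{j\in[n]: v\to v\oplus j\}$ is nonempty, choose some $i\in\mathcal{O}$ (according to the pivot rule) and replace $v$ by $v\oplus i$ (one iteration); return $v$ when $\mathcal{O}=\emptyset$. An arbitrary pivot rule means the choices of $i\in\mathcal{O}$ may be made in any way. *)

theory Defs
  imports "HOL-Analysis.Analysis"
begin

(* The Leibniz formula of "det_def" with UNIV replaced by S, that is, the determinant of the
   submatrix of M with rows and columns in S.  (The submatrix itself would need a separate
   index type for each S.) *)
definition principal_minor :: "real^'n^'n \<Rightarrow> 'n::finite set \<Rightarrow> real" where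
  "principal_minor M S =
     (\<Sum>p | p permutes S. of_int (sign p) * (\<Prod>i\<in>S. M $ i $ p i))"

lemma principal_minor_UNIV: "principal_minor M UNIV = det M"
  by (simp add: principal_minor_def det_def)

lemma principal_minor_singleton: "principal_minor M {i} = M $ i $ i"
  by (simp add: principal_minor_def)

definition P_matrix :: "real^'n^'n::finite \<Rightarrow> bool" where
  "P_matrix M \<longleftrightarrow> (\<forall>S. S \<noteq> {} \<longrightarrow> principal_minor M S > 0)"

definition K_matrix :: "real^'n^'n::finite \<Rightarrow> bool" where
  "K_matrix M \<longleftrightarrow> P_matrix M \<and> (\<forall>i j. i \<noteq> j \<longrightarrow> M $ i $ j \<le> 0)"

(* The order on vectors is the componentwise one. *)
definition lcp_solution ::
  "real^'n^'n \<Rightarrow> real^'n \<Rightarrow> real^'n::finite \<Rightarrow> real^'n \<Rightarrow> bool" where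
  "lcp_solution M q w z \<longleftrightarrow> w - M *v z = q \<and> 0 \<le> w \<and> 0 \<le> z \<and> w \<bullet> z = 0"


(* Vertices of the n-cube: True stands for 1 and False for 0. *)
type_synonym 'n vertex = "bool^'n"

definition flip :: "'n::finite vertex \<Rightarrow> 'n \<Rightarrow> 'n vertex" (infixl "\<oplus>" 65) where
  "v \<oplus> i = (\<chi> j. if j = i then \<not> v $ j else v $ j)"

definition subcube :: "'n::finite vertex \<Rightarrow> 'n set \<Rightarrow> 'n vertex set" where
  "subcube v I = {u. \<forall>j. j \<notin> I \<longrightarrow> u $ j = v $ j}"

(* An orientation is the set of its directed edges: each edge of the cube gets exactly one
   of its two directions. *)
definition cube_orientation :: "('n::finite vertex \<times> 'n vertex) set \<Rightarrow> bool" where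
  "cube_orientation \<phi> \<longleftrightarrow>
     \<phi> \<subseteq> {(v, v \<oplus> i) | v i. True} \<and>
     (\<forall>v i. (v, v \<oplus> i) \<in> \<phi> \<longleftrightarrow> (v \<oplus> i, v) \<notin> \<phi>)"

definition is_sink ::
  "('n::finite vertex \<times> 'n vertex) set \<Rightarrow> 'n vertex set \<Rightarrow> 'n vertex \<Rightarrow> bool" where
  "is_sink \<phi> C u \<longleftrightarrow> u \<in> C \<and> (\<forall>x\<in>C. (u, x) \<notin> \<phi>)"

definition unique_sink_orientation :: "('n::finite vertex \<times> 'n vertex) set \<Rightarrow> bool" where
  "unique_sink_orientation \<phi> \<longleftrightarrow>
     cube_orientation \<phi> \<and> (\<forall>v I. \<exists>!u. is_sink \<phi> (subcube v I) u)"


definition ones :: "'n::finite vertex \<Rightarrow> 'n set" where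
  "ones v = {j. v $ j}"

definition basis_matrix :: "real^'n^'n \<Rightarrow> 'n::finite set \<Rightarrow> real^'n^'n" where
  "basis_matrix M B = (\<chi> r c. if c \<in> B then (- M) $ r $ c else mat 1 $ r $ c)"

definition basic_vector :: "real^'n^'n \<Rightarrow> real^'n \<Rightarrow> 'n::finite set \<Rightarrow> real^'n" where
  "basic_vector M q B = matrix_inv (basis_matrix M B) *v q"

definition nondegenerate :: "real^'n^'n \<Rightarrow> real^'n::finite \<Rightarrow> bool" where
  "nondegenerate M q \<longleftrightarrow> (\<forall>B i. basic_vector M q B $ i \<noteq> 0)"

definition lcp_orientation ::
  "real^'n^'n \<Rightarrow> real^'n::finite \<Rightarrow> ('n vertex \<times> 'n vertex) set" where
  "lcp_orientation M q = {(v, v \<oplus> i) | v i. basic_vector M q (ones v) $ i < 0}"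

definition vertex_w :: "real^'n^'n \<Rightarrow> real^'n \<Rightarrow> 'n::finite vertex \<Rightarrow> real^'n" where
  "vertex_w M q v = (\<chi> i. if i \<in> ones v then 0 else basic_vector M q (ones v) $ i)"

definition vertex_z :: "real^'n^'n \<Rightarrow> real^'n \<Rightarrow> 'n::finite vertex \<Rightarrow> real^'n" where
  "vertex_z M q v = (\<chi> i. if i \<in> ones v then basic_vector M q (ones v) $ i else 0)"


definition outset :: "('n::finite vertex \<times> 'n vertex) set \<Rightarrow> 'n vertex \<Rightarrow> 'n set" where
  "outset \<phi> v = {j. (v, v \<oplus> j) \<in> \<phi>}"

(* A pivot rule chooses a coordinate from the whole list of vertices visited so far (the
   current one last), not just from the current vertex.  Hence every sequence of admissible
   choices comes from some pivot rule. *)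
definition pivot_rule ::
  "('n::finite vertex \<times> 'n vertex) set \<Rightarrow> ('n vertex list \<Rightarrow> 'n) \<Rightarrow> bool" where
  "pivot_rule \<phi> r \<longleftrightarrow>
     (\<forall>h. h \<noteq> [] \<and> outset \<phi> (last h) \<noteq> {} \<longrightarrow> r h \<in> outset \<phi> (last h))"

(* The lists of visited vertices, the start vertex first, that occur while the simple
   principal pivoting algorithm runs. *)
inductive pivoting_history ::
  "('n::finite vertex \<times> 'n vertex) set \<Rightarrow> ('n vertex list \<Rightarrow> 'n) \<Rightarrow> 'n vertex \<Rightarrow>
     'n vertex list \<Rightarrow> bool"
  for \<phi> r v where
  start: "pivoting_history \<phi> r v [v]"
| iterate: "pivoting_history \<phi> r v (h @ [last h \<oplus> r h])"
    if "pivoting_history \<phi> r v h" and "outset \<phi> (last h) \<noteq> {}"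

definition pivoting_returns ::
  "('n::finite vertex \<times> 'n vertex) set \<Rightarrow> ('n vertex list \<Rightarrow> 'n) \<Rightarrow> 'n vertex \<Rightarrow>
     nat \<Rightarrow> 'n vertex \<Rightarrow> bool" where
  "pivoting_returns \<phi> r v k u \<longleftrightarrow>
     (\<exists>h. pivoting_history \<phi> r v h \<and> length h = Suc k \<and> last h = u \<and> outset \<phi> u = {})"

end

theory Submission
  imports Defs
begin

text \<open>
  A \<open>P\<close>-matrix reverses the sign of no nonzero vector: \<open>z\<^sub>i (M z)\<^sub>i \<le> 0\<close> for all \<open>i\<close>
  forces \<open>z = 0\<close>, since otherwise \<open>M + D\<close> would be singular on the support of \<open>z\<close> for some
  nonnegative diagonal \<open>D\<close>. Applied to the difference of the \<open>z\<close>-parts of two vertices, this makes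
  the outmap injective, hence bijective, on every subcube, so that every subcube has a unique sink.
  For a \<open>K\<close>-matrix, a minimum principle shows moreover that the \<open>z\<close>-part grows componentwise along
  every directed edge, and the pivoted coordinate either turns from negative to \<open>0\<close> or from \<open>0\<close>
  to positive. Hence \<open>\<Sum>\<^sub>i sgn z\<^sub>i\<close>, which lies between \<open>-n\<close> and \<open>n\<close>, increases by at least 1
  in every iteration.
\<close>

section \<open>P-matrices: diagonal perturbation and sign reversal\<close>

text \<open>In the Leibniz formula only permutations fixing \<open>k\<close> pick up the summand
  \<open>t\<close>, and these are exactly the permutations of \<open>S - {k}\<close>.\<close>

lemma principal_minor_add_diagonal_entry:
  fixes M :: "real^'n^'n::finite"
  assumes "k \<in> S"
  shows "principal_minor (\<chi> i j. M $ i $ j + (if i = k \<and> j = k then t else 0)) S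
    = principal_minor M S + t * principal_minor M (S - {k})"
proof -
  let ?N = "\<chi> i j. M $ i $ j + (if i = k \<and> j = k then t else 0)"
  have prod_N: "(\<Prod>i\<in>S. ?N $ i $ p i)
      = (\<Prod>i\<in>S. M $ i $ p i) + (if p k = k then t * (\<Prod>i\<in>S - {k}. M $ i $ p i) else 0)" for p
    using assms by (simp add: prod.remove[of S k] algebra_simps)
  have perms: "{p. p permutes S - {k}} = {p \<in> {p. p permutes S}. p k = k}"
    using assms by (auto simp: permutes_def)
  have "principal_minor ?N S = principal_minor M S +
      (\<Sum>p | p permutes S. if p k = k then t * (of_int (sign p) * (\<Prod>i\<in>S - {k}. M $ i $ p i)) else 0)"
    unfolding principal_minor_def prod_N sum.distrib[symmetric]
    by (rule sum.cong) (auto simp: algebra_simps)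
  also have "\<dots> = principal_minor M S + t * principal_minor M (S - {k})"
    unfolding principal_minor_def perms sum_distrib_left
    by (subst sum.inter_filter) (auto simp: finite_permutations)
  finally show ?thesis .
qed

text \<open>Includes the empty minor, which is 1; it arises below as \<open>S - {k}\<close> for a
  singleton \<open>S\<close>.\<close>

lemma P_matrix_principal_minor_pos:
  assumes "P_matrix M"
  shows "principal_minor M S > 0"
  using assms by (cases "S = {}") (auto simp: P_matrix_def principal_minor_def)

lemma P_matrix_add_diagonal_entry:
  fixes M :: "real^'n^'n::finite"
  assumes "P_matrix M" and "t \<ge> 0"
  shows "P_matrix (\<chi> i j. M $ i $ j + (if i = k \<and> j = k then t else 0))"
  unfolding P_matrix_def
proof (intro allI impI)
  fix S :: "'n set"
  let ?N = "\<chi> i j. M $ i $ j + (if i = k \<and> j = k then t else 0)"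
  note pos = P_matrix_principal_minor_pos[OF assms(1)]
  show "principal_minor ?N S > 0"
  proof (cases "k \<in> S")
    case True
    then show ?thesis
      using pos[of S] pos[of "S - {k}"] \<open>t \<ge> 0\<close>
      by (simp add: principal_minor_add_diagonal_entry add_pos_nonneg)
  next
    case False
    then have "principal_minor ?N S = principal_minor M S"
      unfolding principal_minor_def by (intro sum.cong prod.cong arg_cong2[where f = "(*)"]) auto
    then show ?thesis using pos by simp
  qed
qed

lemma P_matrix_add_diagonal:
  fixes M :: "real^'n^'n::finite"
  assumes "P_matrix M" and "\<And>i. d i \<ge> 0"
  shows "P_matrix (\<chi> i j. M $ i $ j + (if i = j then d i else 0))"
proof -
  \<comment> \<open>The diagonal is raised one entry at a time; \<open>T\<close> collects the
    positions already raised.\<close>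
  have "P_matrix (\<chi> i j. M $ i $ j + (if i = j \<and> i \<in> T then d i else 0))" for T
    using finite[of T]
  proof (induction T rule: finite_induct)
    case empty
    have "(\<chi> i j. M $ i $ j) = M" by (simp add: vec_eq_iff)
    then show ?case using assms(1) by simp
  next
    case (insert k T)
    have eq: "(\<chi> i j. M $ i $ j + (if i = j \<and> i \<in> insert k T then d i else 0)) =
        (\<chi> i j. (\<chi> i j. M $ i $ j + (if i = j \<and> i \<in> T then d i else 0)) $ i $ j
          + (if i = k \<and> j = k then d k else 0))"
      using insert.hyps by (auto simp: vec_eq_iff)
    show ?case
      unfolding eq by (rule P_matrix_add_diagonal_entry[OF insert.IH assms(2)])
  qed
  from this[of UNIV] show ?thesis by simp
qed

text \<open>A permutation that moves a point outside \<open>S\<close> meets a zero of an identity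
  row, so only permutations of \<open>S\<close> survive. This turns a minor into a full-size
  determinant, to which invertibility criteria apply.\<close>

lemma det_unit_rows_outside:
  fixes M :: "real^'n^'n::finite"
  shows "det (\<chi> i j. if i \<in> S then M $ i $ j else mat 1 $ i $ j) = principal_minor M S"
proof -
  let ?N = "\<chi> i j. if i \<in> S then M $ i $ j else (mat 1 :: real^'n^'n) $ i $ j"
  have "det ?N = (\<Sum>p | p permutes S. of_int (sign p) * (\<Prod>i\<in>UNIV. ?N $ i $ p i))"
    unfolding det_def
  proof (rule sum.mono_neutral_right)
    show "\<forall>p\<in>{p. p permutes UNIV} - {p. p permutes S}.
        of_int (sign p) * (\<Prod>i\<in>UNIV. ?N $ i $ p i) = 0"
    proof
      fix p assume "p \<in> {p. p permutes (UNIV :: 'n set)} - {p. p permutes S}"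
      then obtain i where "i \<notin> S" "p i \<noteq> i"
        using permutes_superset[of p UNIV S] by auto
      then have "?N $ i $ p i = 0" by (simp add: mat_def)
      then have "(\<Prod>i\<in>UNIV. ?N $ i $ p i) = 0" by (intro prod_zero bexI[of _ i]) simp_all
      then show "of_int (sign p) * (\<Prod>i\<in>UNIV. ?N $ i $ p i) = 0" by simp
    qed
    show "{p. p permutes S} \<subseteq> {p. p permutes UNIV}"
      using permutes_subset[OF _ subset_UNIV] by blast
  qed (simp add: finite_permutations)
  also have "\<dots> = principal_minor M S"
    unfolding principal_minor_def
  proof (rule sum.cong)
    fix p assume "p \<in> {p. p permutes S}"
    then have "(\<Prod>i\<in>S. ?N $ i $ p i) = (\<Prod>i\<in>UNIV. ?N $ i $ p i)"
      by (intro prod.mono_neutral_left) (simp_all add: permutes_not_in mat_def)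
    then show "of_int (sign p) * (\<Prod>i\<in>UNIV. ?N $ i $ p i) = of_int (sign p) * (\<Prod>i\<in>S. M $ i $ p i)"
      by simp
  qed simp
  finally show ?thesis .
qed

lemma P_matrix_kernel_on_support:
  fixes M :: "real^'n^'n::finite"
  assumes "P_matrix M" and "\<And>i. i \<notin> S \<Longrightarrow> z $ i = 0" and "\<And>i. i \<in> S \<Longrightarrow> (M *v z) $ i = 0"
  shows "z = 0"
proof -
  let ?N = "\<chi> i j. if i \<in> S then M $ i $ j else (mat 1 :: real^'n^'n) $ i $ j"
  have "principal_minor M S \<noteq> 0"
    using P_matrix_principal_minor_pos[OF assms(1), of S] by simp
  then have inv: "invertible ?N"
    by (simp add: invertible_det_nz det_unit_rows_outside)
  have "(?N *v z) $ i = (if i \<in> S then (M *v z) $ i else (mat 1 *v z) $ i)" for i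
    by (simp add: matrix_vector_mult_def)
  then have "(?N *v z) $ i = 0" for i
    using assms(2,3)[of i] by simp
  then have "?N *v z = 0" by (simp add: vec_eq_iff)
  then show ?thesis using inv matrix_left_invertible_ker[of ?N] by (auto simp: invertible_def)
qed

lemma P_matrix_no_sign_reversal:
  fixes M :: "real^'n^'n::finite"
  assumes "P_matrix M" and rev: "\<And>i. z $ i * (M *v z) $ i \<le> 0"
  shows "z = 0"
proof -
  \<comment> \<open>On the support of \<open>z\<close>, \<open>d i\<close> solves (M z)_i + d_i z_i
    = 0; sign reversal is what makes it nonnegative.\<close>
  define d where "d i = (if z $ i = 0 then 0 else - (M *v z) $ i / z $ i)" for i
  let ?N = "\<chi> i j. M $ i $ j + (if i = j then d i else 0)"
  have "d i \<ge> 0" for i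
    using rev[of i] by (auto simp: d_def divide_le_0_iff mult_le_0_iff)
  then have "P_matrix ?N" using assms(1) by (intro P_matrix_add_diagonal)
  moreover have "(?N *v z) $ i = 0" if "i \<in> {i. z $ i \<noteq> 0}" for i
  proof -
    have "(?N *v z) $ i = (M *v z) $ i + d i * z $ i"
      unfolding matrix_vector_mult_def
      by (simp add: distrib_right sum.distrib if_distrib[of "\<lambda>x. x * _"] cong: if_cong)
    then show ?thesis using that by (simp add: d_def)
  qed
  ultimately show ?thesis
    by (intro P_matrix_kernel_on_support[of ?N "{i. z $ i \<noteq> 0}"]) auto
qed

lemma K_matrix_minimum_principle:
  fixes M :: "real^'n^'n::finite"
  assumes "K_matrix M" and nonneg: "\<And>i. z $ i < 0 \<Longrightarrow> (M *v z) $ i \<ge> 0"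
  shows "z $ i \<ge> 0"
proof -
  \<comment> \<open>\<open>a\<close> is the negative part of \<open>z\<close>, so
    \<open>a + z\<close> is the positive part. Where \<open>z\<close> is negative, only off-diagonal
    entries of \<open>M\<close> act on the positive part, hence M a + M z is nonpositive there. Thus
    \<open>M\<close> reverses the sign of \<open>a\<close>, which forces
    \<open>a = 0\<close>.\<close>
  define a where "a = (\<chi> i. max (- z $ i) 0)"
  have "a $ i * (M *v a) $ i \<le> 0" for i
  proof (cases "z $ i < 0")
    case True
    have "(M *v a) $ i + (M *v z) $ i = (\<Sum>j\<in>UNIV. M $ i $ j * max (z $ j) 0)"
      unfolding matrix_vector_mult_def a_def
      by (auto simp: sum.distrib[symmetric] max_def intro!: sum.cong)
    also have "\<dots> \<le> 0"
    proof (rule sum_nonpos)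
      fix j show "M $ i $ j * max (z $ j) 0 \<le> 0"
        using assms(1) True by (cases "j = i") (auto simp: K_matrix_def mult_nonpos_nonneg)
    qed
    finally have "(M *v a) $ i \<le> 0" using nonneg[OF True] by simp
    then show ?thesis by (intro mult_nonneg_nonpos) (simp_all add: a_def)
  qed (simp add: a_def)
  then have "a = 0"
    using assms(1) by (intro P_matrix_no_sign_reversal) (auto simp: K_matrix_def)
  then have "a $ i = 0" by simp
  then show ?thesis by (simp add: a_def max_def split: if_splits)
qed

section \<open>Basis matrices and the linear equation of the LCP\<close>

lemma basis_matrix_mult:
  fixes M :: "real^'n^'n::finite"
  shows "basis_matrix M B *v x =
    (\<chi> i. if i \<in> B then 0 else x $ i) - M *v (\<chi> i. if i \<in> B then x $ i else 0)"
proof -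
  have "(basis_matrix M B *v x) $ i =
    (\<Sum>j\<in>UNIV. (if i = j then (if i \<in> B then 0 else x $ i) else 0)
      - M $ i $ j * (if j \<in> B then x $ j else 0))" for i
    unfolding matrix_vector_mult_def basis_matrix_def
    by (auto simp: mat_def intro!: sum.cong)
  then show ?thesis
    by (simp add: vec_eq_iff sum_subtractf matrix_vector_mult_def)
qed

text \<open>A kernel vector splits into \<open>w\<close> and \<open>z\<close> parts with disjoint
  supports and M z = w, so every product z_i (M z)_i is 0.\<close>

lemma P_matrix_invertible_basis_matrix:
  fixes M :: "real^'n^'n::finite"
  assumes "P_matrix M"
  shows "invertible (basis_matrix M B)"
proof -
  have "x = 0" if "basis_matrix M B *v x = 0" for x
  proof -
    let ?w = "\<chi> i. if i \<in> B then 0 else x $ i" and ?z = "\<chi> i. if i \<in> B then x $ i else 0"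
    have w: "M *v ?z = ?w" using that by (simp add: basis_matrix_mult)
    have "?z = 0"
      using assms by (rule P_matrix_no_sign_reversal) (simp add: w)
    moreover from this w have "?w = 0" by simp
    ultimately show ?thesis by (simp add: vec_eq_iff) metis
  qed
  then show ?thesis
    using matrix_left_invertible_ker[of "basis_matrix M B"] invertible_left_inverse by blast
qed

lemma vertex_w_minus_vertex_z:
  fixes M :: "real^'n^'n::finite"
  assumes "P_matrix M"
  shows "vertex_w M q v - M *v vertex_z M q v = q"
proof -
  have "basis_matrix M (ones v) *v basic_vector M q (ones v) = q"
    using P_matrix_invertible_basis_matrix[OF assms]
    unfolding invertible_def basic_vector_def matrix_inv_def matrix_vector_mul_assoc
    by (rule someI2_ex) simp
  then show ?thesis
    by (simp add: basis_matrix_mult vertex_w_def vertex_z_def)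
qed

text \<open>Since M (z' - z) = w' - w, the last hypothesis says that \<open>M\<close> reverses the
  sign of z' - z. Serves both to separate vertices and to show that the LCP has only one
  solution.\<close>

lemma P_matrix_solutions_equal:
  fixes M :: "real^'n^'n::finite"
  assumes "P_matrix M" and "w - M *v z = q" and "w' - M *v z' = q"
    and "\<And>i. (z' $ i - z $ i) * (w' $ i - w $ i) \<le> 0"
  shows "w' = w \<and> z' = z"
proof -
  have diff: "M *v (z' - z) = w' - w"
    using assms(2,3) by (auto simp: matrix_vector_mult_diff_distrib algebra_simps)
  have "z' - z = 0"
    using assms(1) by (rule P_matrix_no_sign_reversal) (simp add: diff assms(4))
  then show ?thesis using diff by simp
qed

section \<open>The induced orientation and its unique sinks\<close>

lemma vertex_coordinates:
  "vertex_w M q v $ i = (if v $ i then 0 else basic_vector M q (ones v) $ i)"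
  "vertex_z M q v $ i = (if v $ i then basic_vector M q (ones v) $ i else 0)"
  by (simp_all add: vertex_w_def vertex_z_def ones_def)

lemma flip_nth: "(v \<oplus> i) $ j = (if j = i then \<not> v $ j else v $ j)"
  by (simp add: flip_def)

lemma flip_flip: "v \<oplus> i \<oplus> i = v"
  by (simp add: vec_eq_iff flip_nth)

lemma flip_eq_iff: "v \<oplus> i = v \<oplus> j \<longleftrightarrow> i = j"
  by (metis flip_nth)

lemma flip_mem_lcp_orientation_iff:
  "(v, v \<oplus> i) \<in> lcp_orientation M q \<longleftrightarrow> basic_vector M q (ones v) $ i < 0"
  by (auto simp: lcp_orientation_def flip_eq_iff)

text \<open>By nondegeneracy the support of the \<open>z\<close> part is exactly the set of ones of
  the vertex.\<close>

lemma vertex_z_inject: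
  fixes M :: "real^'n^'n::finite"
  assumes "nondegenerate M q" and "vertex_z M q u = vertex_z M q v"
  shows "u = v"
  using assms by (simp add: vec_eq_iff vertex_coordinates nondegenerate_def) metis

text \<open>This is the Szabo-Welzl condition on outmaps. If it failed, the products of the
  \<open>z\<close> and \<open>w\<close> differences would all be nonpositive: where the vertices
  agree one factor is 0, and where they differ the product is minus that of two basic entries on the
  same side of 0.\<close>

lemma exists_separating_coordinate:
  fixes M :: "real^'n^'n::finite"
  assumes "P_matrix M" and "nondegenerate M q" and "u \<noteq> v"
  obtains i where "u $ i \<noteq> v $ i"
    and "basic_vector M q (ones u) $ i < 0 \<longleftrightarrow> \<not> basic_vector M q (ones v) $ i < 0"
proof (rule ccontr)
  let ?x = "basic_vector M q (ones u)" and ?y = "basic_vector M q (ones v)"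
  assume "\<not> thesis"
  with that have same: "u $ i \<noteq> v $ i \<Longrightarrow> ?x $ i < 0 \<longleftrightarrow> ?y $ i < 0" for i by blast
  have "(vertex_z M q v $ i - vertex_z M q u $ i) * (vertex_w M q v $ i - vertex_w M q u $ i) \<le> 0" for i
    using same[of i]
    by (auto simp: vertex_coordinates mult_le_0_iff zero_le_mult_iff not_less)
  with assms(1) have "vertex_z M q v = vertex_z M q u"
    using P_matrix_solutions_equal vertex_w_minus_vertex_z by blast
  with assms(2,3) show False using vertex_z_inject by metis
qed

text \<open>The endpoints of an edge differ only at \<open>i\<close>, so the separating coordinate
  can only be \<open>i\<close>.\<close>

lemma basic_vector_flip_less_iff:
  fixes M :: "real^'n^'n::finite"
  assumes "P_matrix M" and "nondegenerate M q"
  shows "basic_vector M q (ones (v \<oplus> i)) $ i < 0 \<longleftrightarrow> \<not> basic_vector M q (ones v) $ i < 0"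
proof -
  have "v \<oplus> i \<noteq> v" by (metis flip_nth)
  with assms obtain j where j: "(v \<oplus> i) $ j \<noteq> v $ j"
    "basic_vector M q (ones (v \<oplus> i)) $ j < 0 \<longleftrightarrow> \<not> basic_vector M q (ones v) $ j < 0"
    by (rule exists_separating_coordinate)
  then have "j = i" by (auto simp: flip_nth split: if_splits)
  with j show ?thesis by simp
qed

lemma cube_orientation_lcp_orientation:
  fixes M :: "real^'n^'n::finite"
  assumes "P_matrix M" and "nondegenerate M q"
  shows "cube_orientation (lcp_orientation M q)"
  unfolding cube_orientation_def
proof (intro conjI allI)
  show "lcp_orientation M q \<subseteq> {(v, v \<oplus> i) | v i. True}"
    by (auto simp: lcp_orientation_def)
  fix v i
  have "(v \<oplus> i, v) \<in> lcp_orientation M q \<longleftrightarrow> (v \<oplus> i, v \<oplus> i \<oplus> i) \<in> lcp_orientation M q"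
    by (simp add: flip_flip)
  then show "(v, v \<oplus> i) \<in> lcp_orientation M q \<longleftrightarrow> (v \<oplus> i, v) \<notin> lcp_orientation M q"
    using basic_vector_flip_less_iff[OF assms] by (simp add: flip_mem_lcp_orientation_iff)
qed

lemma is_sink_subcube_iff:
  "is_sink (lcp_orientation M q) (subcube v I) u \<longleftrightarrow>
    u \<in> subcube v I \<and> {i \<in> I. basic_vector M q (ones u) $ i < 0} = {}"
proof -
  have mem: "u \<in> subcube v I \<Longrightarrow> u \<oplus> i \<in> subcube v I \<longleftrightarrow> i \<in> I" for i
    by (auto simp: subcube_def flip_nth)
  have "(\<exists>x\<in>subcube v I. (u, x) \<in> lcp_orientation M q) \<longleftrightarrow>
      (\<exists>i. u \<oplus> i \<in> subcube v I \<and> basic_vector M q (ones u) $ i < 0)"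
    by (auto simp: lcp_orientation_def)
  then show ?thesis
    unfolding is_sink_def using mem by blast
qed

lemma bij_betw_subcube_Pow: "bij_betw (\<lambda>u. ones u \<inter> I) (subcube v I) (Pow I)"
proof (rule bij_betw_byWitness[where f' = "\<lambda>J. \<chi> j. if j \<in> I then j \<in> J else v $ j"])
qed (auto simp: subcube_def ones_def vec_eq_iff)

lemma unique_sink_orientation_lcp_orientation:
  fixes M :: "real^'n^'n::finite"
  assumes "P_matrix M" and "nondegenerate M q"
  shows "unique_sink_orientation (lcp_orientation M q)"
  unfolding unique_sink_orientation_def
proof (intro conjI allI)
  show "cube_orientation (lcp_orientation M q)"
    using assms by (rule cube_orientation_lcp_orientation)
  fix v :: "'n vertex" and I :: "'n set"
  define out where "out u = {i \<in> I. basic_vector M q (ones u) $ i < 0}" for u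
  have inj: "inj_on out (subcube v I)"
  proof (rule inj_onI, rule ccontr)
    fix u u' assume sub: "u \<in> subcube v I" "u' \<in> subcube v I" and "out u = out u'" "u \<noteq> u'"
    moreover obtain i where "u $ i \<noteq> u' $ i"
      "basic_vector M q (ones u) $ i < 0 \<longleftrightarrow> \<not> basic_vector M q (ones u') $ i < 0"
      using exists_separating_coordinate[OF assms \<open>u \<noteq> u'\<close>] .
    \<comment> \<open>Vertices of the subcube agree outside \<open>I\<close>, so the separating
      coordinate is visible to \<open>out\<close>.\<close>
    moreover from this sub have "i \<in> I" by (auto simp: subcube_def)
    ultimately show False by (auto simp: out_def set_eq_iff)
  qed
  have "card (subcube v I) = card (Pow I)"
    using bij_betw_subcube_Pow by (rule bij_betw_same_card)
  \<comment> \<open>An injection into a set of the same finite size is onto; the sink is the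
    preimage of the empty set.\<close>
  then have "out ` subcube v I = Pow I"
    using card_image[OF inj] by (intro card_subset_eq) (auto simp: out_def)
  then have "{} \<in> out ` subcube v I" by simp
  with inj have "\<exists>!u. u \<in> subcube v I \<and> out u = {}"
    by (metis (no_types, lifting) imageE inj_onD)
  then show "\<exists>!u. is_sink (lcp_orientation M q) (subcube v I) u"
    by (simp add: is_sink_subcube_iff out_def)
qed

section \<open>Growth of the \<open>z\<close> part along directed edges and the length bound\<close>

lemma vertex_z_edge:
  fixes M :: "real^'n^'n::finite"
  assumes "K_matrix M" and "nondegenerate M q" and neg: "basic_vector M q (ones v) $ i < 0"
  shows "vertex_z M q v $ j \<le> vertex_z M q (v \<oplus> i) $ j"
    and "vertex_z M q v $ i < 0 \<and> vertex_z M q (v \<oplus> i) $ i = 0 \<or>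
      vertex_z M q v $ i = 0 \<and> vertex_z M q (v \<oplus> i) $ i > 0"
proof -
  have P: "P_matrix M" using assms(1) by (simp add: K_matrix_def)
  have "basic_vector M q (ones (v \<oplus> i)) $ i > 0"
    using basic_vector_flip_less_iff[OF P assms(2), of v i] neg assms(2)
    by (simp add: not_less order_le_less nondegenerate_def)
  \<comment> \<open>The first alternative is the pivot from bit 1 to 0, the second from 0 to 1. It
    is shown first because it gives a positive difference at \<open>i\<close>, needed for the
    minimum principle.\<close>
  then show step: "vertex_z M q v $ i < 0 \<and> vertex_z M q (v \<oplus> i) $ i = 0 \<or>
      vertex_z M q v $ i = 0 \<and> vertex_z M q (v \<oplus> i) $ i > 0"
    using neg by (auto simp: vertex_coordinates flip_nth)
  let ?d = "vertex_z M q (v \<oplus> i) - vertex_z M q v"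
  have diff: "M *v ?d = vertex_w M q (v \<oplus> i) - vertex_w M q v"
    using vertex_w_minus_vertex_z[OF P, of q v] vertex_w_minus_vertex_z[OF P, of q "v \<oplus> i"]
    by (simp add: matrix_vector_mult_diff_distrib algebra_simps)
  \<comment> \<open>Off \<open>i\<close> both vertices have the same bit. Bit 0 would make both
    \<open>z\<close> entries 0, so the bit is 1, both \<open>w\<close> entries vanish and (M d)_k =
    0.\<close>
  have "(M *v ?d) $ k \<ge> 0" if "?d $ k < 0" for k
  proof -
    have "k \<noteq> i" using step that by auto
    with that show ?thesis
      unfolding diff by (simp add: vertex_coordinates flip_nth split: if_splits)
  qed
  then have "?d $ j \<ge> 0"
    by (rule K_matrix_minimum_principle[OF assms(1)])
  then show "vertex_z M q v $ j \<le> vertex_z M q (v \<oplus> i) $ j" by simp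
qed

text \<open>No summand decreases because \<open>sgn\<close> is monotone, and the summand at
  \<open>i\<close> goes from -1 to 0 or from 0 to 1.\<close>

lemma sum_sgn_vertex_z_edge:
  fixes M :: "real^'n^'n::finite"
  assumes "K_matrix M" and "nondegenerate M q" and "basic_vector M q (ones v) $ i < 0"
  shows "(\<Sum>j\<in>UNIV. sgn (vertex_z M q v $ j)) + 1 \<le> (\<Sum>j\<in>UNIV. sgn (vertex_z M q (v \<oplus> i) $ j))"
proof -
  have "(\<Sum>j\<in>UNIV. sgn (vertex_z M q v $ j)) + 1
      = (\<Sum>j\<in>UNIV. sgn (vertex_z M q v $ j) + (if j = i then 1 else 0))"
    by (simp add: sum.distrib)
  also have "\<dots> \<le> (\<Sum>j\<in>UNIV. sgn (vertex_z M q (v \<oplus> i) $ j))"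
  proof (rule sum_mono)
    fix j
    show "sgn (vertex_z M q v $ j) + (if j = i then 1 else 0) \<le> sgn (vertex_z M q (v \<oplus> i) $ j)"
      using vertex_z_edge(1)[OF assms, of j] vertex_z_edge(2)[OF assms]
      by (auto simp: sgn_if)
  qed
  finally show ?thesis .
qed

lemma pivoting_history_length_le:
  fixes M :: "real^'n^'n::finite"
  assumes "K_matrix M" and "nondegenerate M q" and "pivot_rule (lcp_orientation M q) r"
    and "pivoting_history (lcp_orientation M q) r v h"
  shows "length h \<le> Suc (2 * CARD('n))"
proof -
  let ?s = "\<lambda>u. \<Sum>j\<in>UNIV. sgn (vertex_z M q u $ j)"
  \<comment> \<open>The 1 accounts for the start vertex, which costs no iteration. Nonemptiness is
    carried along because \<open>pivot_rule\<close> constrains \<open>r\<close> only on nonempty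
    histories.\<close>
  have "h \<noteq> [] \<and> ?s v + real (length h) \<le> ?s (last h) + 1"
    using assms(4)
  proof induction
    case start
    then show ?case by simp
  next
    case (iterate h)
    then have "r h \<in> outset (lcp_orientation M q) (last h)"
      using assms(3) by (simp add: pivot_rule_def)
    then have "basic_vector M q (ones (last h)) $ r h < 0"
      by (simp add: outset_def flip_mem_lcp_orientation_iff)
    from sum_sgn_vertex_z_edge[OF assms(1,2) this] show ?case
      using iterate.IH by simp
  qed
  moreover have "-1 \<le> sgn x" "sgn x \<le> 1" for x :: real by (simp_all add: sgn_if)
  then have "?s u \<le> real CARD('n)" "- real CARD('n) \<le> ?s u" for u
    using sum_bounded_above[of UNIV "\<lambda>j. sgn (vertex_z M q u $ j)" 1]
      sum_bounded_below[of UNIV "-1" "\<lambda>j. sgn (vertex_z M q u $ j)"] by simp_all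
  from this(1)[of "last h"] this(2)[of v] have "?s (last h) - ?s v \<le> 2 * real CARD('n)" by linarith
  ultimately show ?thesis by linarith
qed

section \<open>Termination at a sink\<close>

text \<open>Bounded lengths give a longest history; it must end at a vertex with empty outset, since
  otherwise another iteration would extend it.\<close>

lemma pivoting_returns_if_bounded:
  assumes bound: "\<And>h. pivoting_history \<phi> r v h \<Longrightarrow> length h \<le> Suc n"
  obtains k u where "k \<le> n" and "pivoting_returns \<phi> r v k u"
proof -
  have "\<exists>h. pivoting_history \<phi> r v h \<and> (\<forall>h'. pivoting_history \<phi> r v h' \<longrightarrow> length h' \<le> length h)"
    using bound by (intro ex_has_greatest_nat[where b = "Suc (Suc n)"] start)
      (auto simp: le_imp_less_Suc intro: start)
  then obtain h where h: "pivoting_history \<phi> r v h"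
    and longest: "\<And>h'. pivoting_history \<phi> r v h' \<Longrightarrow> length h' \<le> length h" by blast
  have "outset \<phi> (last h) = {}"
    using longest[OF iterate[OF h]] by auto
  moreover have "length h = Suc (length h - 1)"
    using h by cases auto
  ultimately have "pivoting_returns \<phi> r v (length h - 1) (last h)"
    unfolding pivoting_returns_def using h by blast
  moreover have "length h - 1 \<le> n" using bound[OF h] by simp
  ultimately show thesis using that by blast
qed

lemma is_sink_UNIV_iff_outset:
  assumes "cube_orientation \<phi>"
  shows "is_sink \<phi> UNIV u \<longleftrightarrow> outset \<phi> u = {}"
  using assms by (auto simp: is_sink_def outset_def cube_orientation_def)

section \<open>The sink and the solution of the LCP\<close>

lemma lcp_solution_unique:
  fixes M :: "real^'n^'n::finite"
  assumes "P_matrix M" and "lcp_solution M q w z" and "lcp_solution M q w' z'"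
  shows "w' = w \<and> z' = z"
proof (rule P_matrix_solutions_equal[OF assms(1), of w z q])
  show "w - M *v z = q" "w' - M *v z' = q"
    using assms by (simp_all add: lcp_solution_def)
  have nonneg: "0 \<le> w $ i" "0 \<le> z $ i" "0 \<le> w' $ i" "0 \<le> z' $ i" for i
    using assms by (auto simp: lcp_solution_def less_eq_vec_def)
  have "w \<bullet> z = 0" "w' \<bullet> z' = 0" using assms by (simp_all add: lcp_solution_def)
  \<comment> \<open>A vanishing sum of nonnegative terms has only zero terms. Hence the product of
    differences below reduces to -(z'_i w_i + z_i w'_i).\<close>
  then have compl: "w $ i * z $ i = 0" "w' $ i * z' $ i = 0" for i
    using nonneg by (simp_all add: inner_vec_def sum_nonneg_eq_0_iff)
  show "(z' $ i - z $ i) * (w' $ i - w $ i) \<le> 0" for i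
    using nonneg[of i] compl[of i] by (auto simp: mult_le_0_iff)
qed

text \<open>Complementarity and the linear equation hold at every vertex; the empty outset adds
  nonnegativity.\<close>

lemma lcp_solution_sink:
  fixes M :: "real^'n^'n::finite"
  assumes "P_matrix M" and "outset (lcp_orientation M q) u = {}"
  shows "lcp_solution M q (vertex_w M q u) (vertex_z M q u)"
proof -
  have "0 \<le> basic_vector M q (ones u) $ i" for i
    using assms(2) by (auto simp: outset_def flip_mem_lcp_orientation_iff not_less)
  then have "0 \<le> vertex_w M q u" "0 \<le> vertex_z M q u"
    by (simp_all add: less_eq_vec_def vertex_coordinates)
  moreover have "vertex_w M q u \<bullet> vertex_z M q u = 0"
    by (simp add: inner_vec_def vertex_coordinates sum.neutral)
  ultimately show ?thesis
    using vertex_w_minus_vertex_z[OF assms(1)] by (simp add: lcp_solution_def)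
qed

theorem corollary5p10:
  fixes M :: "real^'n^'n" and q :: "real^'n"
    and \<phi> :: "('n::finite vertex \<times> 'n vertex) set"
    and r :: "'n vertex list \<Rightarrow> 'n" and v :: "'n vertex"
  assumes "K_matrix M"
    and "nondegenerate M q"
    and "\<phi> = lcp_orientation M q"
    and "pivot_rule \<phi> r"
  shows "unique_sink_orientation \<phi> \<and>
    (\<exists>k u. k \<le> 2 * CARD('n) \<and> pivoting_returns \<phi> r v k u \<and> is_sink \<phi> UNIV u \<and>
       (\<forall>w z. lcp_solution M q w z \<longleftrightarrow> w = vertex_w M q u \<and> z = vertex_z M q u))"
proof -
  have P: "P_matrix M" using assms(1) by (simp add: K_matrix_def)
  have uso: "unique_sink_orientation \<phi>"
    using unique_sink_orientation_lcp_orientation[OF P assms(2)] assms(3) by simp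
  obtain k u where k: "k \<le> 2 * CARD('n)" and returns: "pivoting_returns \<phi> r v k u"
    using pivoting_history_length_le[OF assms(1,2)] assms(3,4)
    by (metis pivoting_returns_if_bounded)
  then have out: "outset \<phi> u = {}" by (auto simp: pivoting_returns_def)
  then have "is_sink \<phi> UNIV u"
    using uso by (simp add: is_sink_UNIV_iff_outset unique_sink_orientation_def)
  moreover have "lcp_solution M q w z \<longleftrightarrow> w = vertex_w M q u \<and> z = vertex_z M q u" for w z
    using lcp_solution_unique[OF P] lcp_solution_sink[OF P] out assms(3) by blast
  ultimately show ?thesis using uso k returns by blast
qed

end
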